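(* Let $K$ be a small category and $G$ a group acting on $K$. This action satisfies Condition (R) if and only if the canonical surjection $\lambda:\Delta(K)/G\to\Delta(K/G)$ is injective on $1$-skeleta.
   Context: For a morphism $m$, $\partial^\bullet m$ denotes its source and $\partial_\bullet m$ its target; $x\circ y$ is defined when $\partial_\bullet x=\partial^\bullet y$ (first $x$, then $y$). Condition (R): if $x,y_a,y_b$ are morphisms of $K$ with $\partial_\bullet x=\partial^\bullet y_a=\partial^\bullet y_b$ and $Gy_a=Gy_b$, then $G(x\circ y_a)=G(x\circ y_b)$, where $Gm$ is the orbit of a morphism $m$. A group $G$ (viewed as a one-object category) acts on $K$ via a functor $\mathcal{A}_K:G\to\mathbf{Cat}$ sending the object to $K$. The quotient $K/G$ is the colimit of $\mathcal{A}_K$ in $\mathbf{Cat}$. Explicitly: objects of $K/G$ are the $G$-orbits of objects of $K$; morphisms are the equivalence classes $[x]$ of morphisms of $K$ under the transitive closure of the relation "$x$ and $y$ have decompositions $x=x_1\circ\dots\circ x_s$, $y=y_1\circ\dots\circ y_s$ with $Gx_i=Gy_i$ for all $i$", with induced source, target and composition. $\Delta:\mathbf{Cat}\to\mathbf{SSet}$ is the nerve functor; $\Delta(K)/G$ is the quotient simplicial set, whose $t$-simplices are the $G$-orbits of chains $(m_1,\dots,m_t)$ of composable morphisms. The canonical map $\lambda$ sends $G(m_1,\dots,m_t)$ to $([m_1],\dots,[m_t])$; it is always surjective. *)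

theory Defs
  imports "HOL-Algebra.Group_Action"
begin

section \<open>Small categories\<close>

text \<open>\<open>Comp K x y\<close> is the composite in diagrammatic order: first \<open>x\<close>, then \<open>y\<close>.
  Outside composable pairs of morphisms its value is irrelevant.\<close>

record ('o, 'm) cat =
  Obj :: "'o set"
  Mor :: "'m set"
  Dom :: "'m \<Rightarrow> 'o"
  Cod :: "'m \<Rightarrow> 'o"
  Ident :: "'o \<Rightarrow> 'm"
  Comp :: "'m \<Rightarrow> 'm \<Rightarrow> 'm"

locale category =
  fixes K :: "('o, 'm) cat"
  assumes Dom_closed: "x \<in> Mor K \<Longrightarrow> Dom K x \<in> Obj K"
    and Cod_closed: "x \<in> Mor K \<Longrightarrow> Cod K x \<in> Obj K"
    and Ident_closed: "a \<in> Obj K \<Longrightarrow> Ident K a \<in> Mor K"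
    and Dom_Ident: "a \<in> Obj K \<Longrightarrow> Dom K (Ident K a) = a"
    and Cod_Ident: "a \<in> Obj K \<Longrightarrow> Cod K (Ident K a) = a"
    and Comp_closed: "\<lbrakk>x \<in> Mor K; y \<in> Mor K; Cod K x = Dom K y\<rbrakk> \<Longrightarrow> Comp K x y \<in> Mor K"
    and Dom_Comp: "\<lbrakk>x \<in> Mor K; y \<in> Mor K; Cod K x = Dom K y\<rbrakk> \<Longrightarrow> Dom K (Comp K x y) = Dom K x"
    and Cod_Comp: "\<lbrakk>x \<in> Mor K; y \<in> Mor K; Cod K x = Dom K y\<rbrakk> \<Longrightarrow> Cod K (Comp K x y) = Cod K y"
    and Comp_assoc: "\<lbrakk>x \<in> Mor K; y \<in> Mor K; z \<in> Mor K; Cod K x = Dom K y; Cod K y = Dom K z\<rbrakk>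
      \<Longrightarrow> Comp K (Comp K x y) z = Comp K x (Comp K y z)"
    and Ident_Comp: "x \<in> Mor K \<Longrightarrow> Comp K (Ident K (Dom K x)) x = x"
    and Comp_Ident: "x \<in> Mor K \<Longrightarrow> Comp K x (Ident K (Cod K x)) = x"
begin

lemmas cat_simps = Dom_closed Cod_closed Ident_closed Dom_Ident Cod_Ident
  Comp_closed Dom_Comp Cod_Comp Ident_Comp Comp_Ident

end

fun chain :: "('o, 'm) cat \<Rightarrow> 'o \<Rightarrow> 'm list \<Rightarrow> bool" where
  "chain K a [] \<longleftrightarrow> a \<in> Obj K"
| "chain K a (m # ms) \<longleftrightarrow> m \<in> Mor K \<and> Dom K m = a \<and> chain K (Cod K m) ms"

fun chain_end :: "('o, 'm) cat \<Rightarrow> 'o \<Rightarrow> 'm list \<Rightarrow> 'o" where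
  "chain_end K a [] = a"
| "chain_end K a (m # ms) = chain_end K (Cod K m) ms"

fun chain_comp :: "('o, 'm) cat \<Rightarrow> 'o \<Rightarrow> 'm list \<Rightarrow> 'm" where
  "chain_comp K a [] = Ident K a"
| "chain_comp K a (m # ms) = Comp K m (chain_comp K (Cod K m) ms)"

context category
begin

lemma chain_start: "chain K a ms \<Longrightarrow> a \<in> Obj K"
  by (cases ms) (auto simp: cat_simps)

lemma chain_end_closed: "chain K a ms \<Longrightarrow> chain_end K a ms \<in> Obj K"
  by (induction ms arbitrary: a) auto

lemma chain_comp_props:
  "chain K a ms \<Longrightarrow> chain_comp K a ms \<in> Mor K \<and> Dom K (chain_comp K a ms) = a
     \<and> Cod K (chain_comp K a ms) = chain_end K a ms"
  by (induction ms arbitrary: a) (auto simp: cat_simps)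

lemma chain_append:
  "chain K a (xs @ ys) \<longleftrightarrow> chain K a xs \<and> chain K (chain_end K a xs) ys"
  by (induction xs arbitrary: a) (auto dest: chain_start)

lemma chain_end_append:
  "chain_end K a (xs @ ys) = chain_end K (chain_end K a xs) ys"
  by (induction xs arbitrary: a) auto

lemma chain_comp_append:
  "\<lbrakk>chain K a xs; chain K (chain_end K a xs) ys\<rbrakk> \<Longrightarrow>
    chain_comp K a (xs @ ys) = Comp K (chain_comp K a xs) (chain_comp K (chain_end K a xs) ys)"
proof (induction xs arbitrary: a)
  case Nil
  then show ?case
    using chain_comp_props[of a ys] Ident_Comp[of "chain_comp K a ys"] by simp
next
  case (Cons x xs)
  then show ?case
    using chain_comp_props[of "Cod K x" xs] chain_comp_props[of "chain_end K (Cod K x) xs" ys]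
    by (simp add: Comp_assoc)
qed

end

section \<open>Group actions on categories\<close>

text \<open>A functor from \<open>G\<close> to \<open>Cat\<close> with value \<open>K\<close> at the only object: a left action on objects
  and on morphisms such that every group element acts as a functor.\<close>

locale category_action =
  category K + ob: group_action G "Obj K" ao + mo: group_action G "Mor K" am
  for G :: "('g, 'b) monoid_scheme"
    and K :: "('o, 'm) cat"
    and ao :: "'g \<Rightarrow> 'o \<Rightarrow> 'o"
    and am :: "'g \<Rightarrow> 'm \<Rightarrow> 'm" +
  assumes act_Dom: "\<lbrakk>g \<in> carrier G; x \<in> Mor K\<rbrakk> \<Longrightarrow> Dom K (am g x) = ao g (Dom K x)"
    and act_Cod: "\<lbrakk>g \<in> carrier G; x \<in> Mor K\<rbrakk> \<Longrightarrow> Cod K (am g x) = ao g (Cod K x)"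
    and act_Ident: "\<lbrakk>g \<in> carrier G; a \<in> Obj K\<rbrakk> \<Longrightarrow> am g (Ident K a) = Ident K (ao g a)"
    and act_Comp: "\<lbrakk>g \<in> carrier G; x \<in> Mor K; y \<in> Mor K; Cod K x = Dom K y\<rbrakk>
      \<Longrightarrow> am g (Comp K x y) = Comp K (am g x) (am g y)"

definition condition_R ::
  "('g, 'b) monoid_scheme \<Rightarrow> ('o, 'm) cat \<Rightarrow> ('g \<Rightarrow> 'm \<Rightarrow> 'm) \<Rightarrow> bool" where
  "condition_R G K am \<longleftrightarrow>
    (\<forall>x \<in> Mor K. \<forall>ya \<in> Mor K. \<forall>yb \<in> Mor K.
      Cod K x = Dom K ya \<longrightarrow> Cod K x = Dom K yb \<longrightarrow> orbit G am ya = orbit G am yb \<longrightarrow>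
      orbit G am (Comp K x ya) = orbit G am (Comp K x yb))"

section \<open>The quotient category\<close>

text \<open>Decompositions have at least one factor; with the empty decomposition allowed, all
  identities would become related.\<close>

definition decomposition :: "('o, 'm) cat \<Rightarrow> 'm list \<Rightarrow> 'm \<Rightarrow> bool" where
  "decomposition K xs x \<longleftrightarrow> xs \<noteq> [] \<and> chain K (Dom K x) xs \<and> chain_comp K (Dom K x) xs = x"

definition mor_rel ::
  "('g, 'b) monoid_scheme \<Rightarrow> ('o, 'm) cat \<Rightarrow> ('g \<Rightarrow> 'm \<Rightarrow> 'm) \<Rightarrow> ('m \<times> 'm) set" where
  "mor_rel G K am = {(x, y). x \<in> Mor K \<and> y \<in> Mor K \<and>
    (\<exists>xs ys. decomposition K xs x \<and> decomposition K ys y \<and>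
       list_all2 (\<lambda>u v. orbit G am u = orbit G am v) xs ys)}"

definition mor_class ::
  "('g, 'b) monoid_scheme \<Rightarrow> ('o, 'm) cat \<Rightarrow> ('g \<Rightarrow> 'm \<Rightarrow> 'm) \<Rightarrow> 'm \<Rightarrow> 'm set" where
  "mor_class G K am x = (mor_rel G K am)\<^sup>+ `` {x}"

text \<open>The structure maps are induced on representatives; that the sets below are singletons
  is what the lemmas \<open>Dom_class\<close> to \<open>Comp_class\<close> show.\<close>

definition quotient_cat ::
  "('g, 'b) monoid_scheme \<Rightarrow> ('o, 'm) cat \<Rightarrow> ('g \<Rightarrow> 'o \<Rightarrow> 'o) \<Rightarrow> ('g \<Rightarrow> 'm \<Rightarrow> 'm)
    \<Rightarrow> ('o set, 'm set) cat" where
  "quotient_cat G K ao am =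
    \<lparr>Obj = orbits G (Obj K) ao,
     Mor = Mor K // (mor_rel G K am)\<^sup>+,
     Dom = (\<lambda>X. the_elem ((\<lambda>x. orbit G ao (Dom K x)) ` X)),
     Cod = (\<lambda>X. the_elem ((\<lambda>x. orbit G ao (Cod K x)) ` X)),
     Ident = (\<lambda>A. the_elem ((\<lambda>a. mor_class G K am (Ident K a)) ` A)),
     Comp = (\<lambda>X Y. the_elem {mor_class G K am (Comp K x y) | x y.
                x \<in> X \<and> y \<in> Y \<and> Cod K x = Dom K y})\<rparr>"

lemma (in group_action) orbit_closed: "x \<in> E \<Longrightarrow> y \<in> orbit G \<phi> x \<Longrightarrow> y \<in> E"
  unfolding orbit_def using element_image by blast

lemma (in group_action) orbit_eqI:
  assumes "x \<in> E" "y \<in> orbit G \<phi> x"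
  shows "orbit G \<phi> y = orbit G \<phi> x"
proof -
  have y: "y \<in> E" using assms orbit_closed by blast
  then have "x \<in> orbit G \<phi> y" using assms orbit_sym by blast
  then show ?thesis
    using assms y orbit_trans orbit_closed by (metis subsetI subset_antisym)
qed

lemma (in group_action) orbit_act:
  "\<lbrakk>x \<in> E; g \<in> carrier G\<rbrakk> \<Longrightarrow> orbit G \<phi> (\<phi> g x) = orbit G \<phi> x"
  by (rule orbit_eqI) (auto simp: orbit_def)

lemma (in group_action) orbit_eqD:
  assumes "x \<in> E" "y \<in> E" "orbit G \<phi> x = orbit G \<phi> y"
  obtains g where "g \<in> carrier G" "\<phi> g x = y"
proof -
  have "y \<in> orbit G \<phi> x" using assms orbit_refl[of y] by simp
  then show thesis using that unfolding orbit_def by auto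
qed

context category_action
begin

lemma act_closed [simp]:
  "\<lbrakk>g \<in> carrier G; a \<in> Obj K\<rbrakk> \<Longrightarrow> ao g a \<in> Obj K"
  "\<lbrakk>g \<in> carrier G; x \<in> Mor K\<rbrakk> \<Longrightarrow> am g x \<in> Mor K"
  using ob.element_image mo.element_image by blast+

lemma orbit_Dom_Cod_cong:
  assumes "x \<in> Mor K" "y \<in> Mor K" "orbit G am x = orbit G am y"
  shows "orbit G ao (Dom K x) = orbit G ao (Dom K y)"
    and "orbit G ao (Cod K x) = orbit G ao (Cod K y)"
  using assms mo.orbit_eqD[OF assms]
  by (metis act_Dom ob.orbit_act Dom_closed, metis act_Cod ob.orbit_act Cod_closed)

lemma decomposition_single: "x \<in> Mor K \<Longrightarrow> decomposition K [x] x"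
  by (simp add: decomposition_def cat_simps)

lemma decomposition_append:
  assumes "decomposition K xs x" "decomposition K ys y" "Cod K x = Dom K y"
  shows "decomposition K (xs @ ys) (Comp K x y)"
proof -
  have "x \<in> Mor K \<and> y \<in> Mor K \<and> Cod K x = chain_end K (Dom K x) xs"
    using assms chain_comp_props unfolding decomposition_def by metis
  then show ?thesis
    using assms unfolding decomposition_def
    by (auto simp: Dom_Comp chain_append chain_comp_append)
qed

abbreviation "rel \<equiv> mor_rel G K am"
abbreviation "cls \<equiv> mor_class G K am"
abbreviation "KG \<equiv> quotient_cat G K ao am"

lemma decomposition_Mor: "decomposition K xs x \<Longrightarrow> x \<in> Mor K"
  unfolding decomposition_def using chain_comp_props by metis

lemma relI:
  "\<lbrakk>decomposition K xs x; decomposition K ys y;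
    list_all2 (\<lambda>u v. orbit G am u = orbit G am v) xs ys\<rbrakk> \<Longrightarrow> (x, y) \<in> rel"
  unfolding mor_rel_def using decomposition_Mor by blast

lemma rel_orbit:
  assumes "x \<in> Mor K" "y \<in> Mor K" "orbit G am x = orbit G am y"
  shows "(x, y) \<in> rel"
  using assms by (intro relI[of "[x]" _ "[y]"] decomposition_single) auto

lemma rel_Comp:
  assumes "(x, x') \<in> rel" "(y, y') \<in> rel" "Cod K x = Dom K y" "Cod K x' = Dom K y'"
  shows "(Comp K x y, Comp K x' y') \<in> rel"
proof -
  obtain xs xs' ys ys' where
    "decomposition K xs x" "decomposition K xs' x'" "decomposition K ys y" "decomposition K ys' y'"
    "list_all2 (\<lambda>u v. orbit G am u = orbit G am v) xs xs'"
    "list_all2 (\<lambda>u v. orbit G am u = orbit G am v) ys ys'"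
    using assms unfolding mor_rel_def by auto
  then show ?thesis
    using assms by (intro relI[of "xs @ ys" _ "xs' @ ys'"] decomposition_append list_all2_appendI)
qed

lemma rel_Dom_Cod_aux:
  assumes "xs \<noteq> []" "chain K a xs" "chain K b ys"
    "list_all2 (\<lambda>u v. orbit G am u = orbit G am v) xs ys"
  shows "orbit G ao a = orbit G ao b \<and> orbit G ao (chain_end K a xs) = orbit G ao (chain_end K b ys)"
  using assms
proof (induction xs arbitrary: a b ys)
  case (Cons x xs)
  obtain y ys' where ys: "ys = y # ys'" using Cons.prems by (cases ys) auto
  have *: "orbit G ao (Dom K x) = orbit G ao (Dom K y)" "orbit G ao (Cod K x) = orbit G ao (Cod K y)"
    using Cons.prems ys orbit_Dom_Cod_cong by auto
  show ?case
  proof (cases "xs = []")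
    case True
    then show ?thesis using Cons.prems ys * by auto
  next
    case False
    then show ?thesis using Cons.IH[OF False, of "Cod K x" "Cod K y" ys'] Cons.prems ys * by auto
  qed
qed simp

lemma rel_Dom_Cod:
  assumes "(x, y) \<in> rel"
  shows "orbit G ao (Dom K x) = orbit G ao (Dom K y) \<and> orbit G ao (Cod K x) = orbit G ao (Cod K y)"
proof -
  obtain xs ys where d: "xs \<noteq> []" "chain K (Dom K x) xs" "chain_comp K (Dom K x) xs = x"
    "chain K (Dom K y) ys" "chain_comp K (Dom K y) ys = y"
    "list_all2 (\<lambda>u v. orbit G am u = orbit G am v) xs ys"
    using assms unfolding mor_rel_def decomposition_def by auto
  then show ?thesis
    using rel_Dom_Cod_aux[OF d(1,2,4,6)] chain_comp_props[OF d(2)] chain_comp_props[OF d(4)] by simp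
qed

lemma rel_Mor: "(x, y) \<in> rel\<^sup>+ \<Longrightarrow> x \<in> Mor K \<and> y \<in> Mor K"
  by (induction rule: trancl_induct) (auto simp: mor_rel_def)

lemma trancl_Dom_Cod:
  "(x, y) \<in> rel\<^sup>+ \<Longrightarrow>
    orbit G ao (Dom K x) = orbit G ao (Dom K y) \<and> orbit G ao (Cod K x) = orbit G ao (Cod K y)"
  by (induction rule: trancl_induct) (auto dest: rel_Dom_Cod)

lemma equiv_rel: "equiv (Mor K) (rel\<^sup>+)"
proof (rule equivI)
  show "refl_on (Mor K) (rel\<^sup>+)"
    using rel_orbit by (auto simp: refl_on_def)
  have "sym rel"
  proof (rule symI)
    fix x y assume "(x, y) \<in> rel"
    then obtain xs ys where "decomposition K xs x" "decomposition K ys y"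
      "list_all2 (\<lambda>u v. orbit G am u = orbit G am v) xs ys"
      unfolding mor_rel_def by auto
    then show "(y, x) \<in> rel"
      by (intro relI[of ys y xs x]) (auto simp: list_all2_conv_all_nth)
  qed
  then show "sym (rel\<^sup>+)" by (rule sym_trancl)
  show "rel\<^sup>+ \<subseteq> Mor K \<times> Mor K" using rel_Mor by auto
qed simp

lemma cls_eq_iff: "\<lbrakk>x \<in> Mor K; y \<in> Mor K\<rbrakk> \<Longrightarrow> cls x = cls y \<longleftrightarrow> (x, y) \<in> rel\<^sup>+"
  unfolding mor_class_def using equiv_rel eq_equiv_class_iff by metis

lemma cls_self: "x \<in> Mor K \<Longrightarrow> x \<in> cls x"
  unfolding mor_class_def using equiv_class_self equiv_rel by metis

lemma mem_cls: "y \<in> cls x \<Longrightarrow> x \<in> Mor K \<and> y \<in> Mor K \<and> (x, y) \<in> rel\<^sup>+ \<and> cls y = cls x"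
  using rel_Mor cls_eq_iff[of x y] unfolding mor_class_def by auto

lemma cls_act: "\<lbrakk>g \<in> carrier G; x \<in> Mor K\<rbrakk> \<Longrightarrow> cls (am g x) = cls x"
  by (subst cls_eq_iff) (auto intro!: r_into_trancl rel_orbit simp: mo.orbit_act)

lemma Mor_KG: "Mor KG = cls ` Mor K"
  by (auto simp: quotient_cat_def mor_class_def quotient_def)

lemma Obj_KG: "Obj KG = orbit G ao ` Obj K"
  by (auto simp: quotient_cat_def orbits_def)

lemma Dom_class:
  assumes "x \<in> Mor K"
  shows "Dom KG (cls x) = orbit G ao (Dom K x)"
proof -
  have "orbit G ao (Dom K y) = orbit G ao (Dom K x)" if "y \<in> cls x" for y
    using mem_cls[OF that] trancl_Dom_Cod[of x y] by simp
  then have "the_elem ((\<lambda>y. orbit G ao (Dom K y)) ` cls x) = orbit G ao (Dom K x)"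
    using cls_self[OF assms] by (intro the_elem_image_unique) blast+
  then show ?thesis by (simp add: quotient_cat_def)
qed

lemma Cod_class:
  assumes "x \<in> Mor K"
  shows "Cod KG (cls x) = orbit G ao (Cod K x)"
proof -
  have "orbit G ao (Cod K y) = orbit G ao (Cod K x)" if "y \<in> cls x" for y
    using mem_cls[OF that] trancl_Dom_Cod[of x y] by simp
  then have "the_elem ((\<lambda>y. orbit G ao (Cod K y)) ` cls x) = orbit G ao (Cod K x)"
    using cls_self[OF assms] by (intro the_elem_image_unique) blast+
  then show ?thesis by (simp add: quotient_cat_def)
qed

lemma Ident_class: "a \<in> Obj K \<Longrightarrow> Ident KG (orbit G ao a) = cls (Ident K a)"
proof -
  assume a: "a \<in> Obj K"
  have "cls (Ident K b) = cls (Ident K a)" if "b \<in> orbit G ao a" for b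
  proof -
    obtain g where g: "g \<in> carrier G" "b = ao g a" using \<open>b \<in> orbit G ao a\<close> unfolding orbit_def by auto
    show ?thesis using cls_act[OF g(1) Ident_closed[OF a]] by (simp only: g(2) act_Ident[OF g(1) a])
  qed
  then have "the_elem ((\<lambda>b. cls (Ident K b)) ` orbit G ao a) = cls (Ident K a)"
    using ob.orbit_refl[OF a] by (intro the_elem_image_unique) blast+
  then show ?thesis by (simp add: quotient_cat_def)
qed

lemma trancl_Comp_left:
  assumes "(x, x') \<in> rel\<^sup>+" "y \<in> Mor K" "Cod K x = Dom K y"
  shows "\<exists>g \<in> carrier G. Cod K x' = Dom K (am g y) \<and> (Comp K x y, Comp K x' (am g y)) \<in> rel\<^sup>+"
  using assms(1)
proof (induction rule: trancl_induct)
  case (base x')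
  have m: "x \<in> Mor K" "x' \<in> Mor K" using base unfolding mor_rel_def by auto
  obtain g where g: "g \<in> carrier G" "ao g (Cod K x) = Cod K x'"
    using rel_Dom_Cod[OF base] m ob.orbit_eqD[of "Cod K x" "Cod K x'"] Cod_closed by blast
  then show ?case
    using rel_Comp[OF base rel_orbit[of y "am g y"]] assms m
    by (auto simp: act_Dom mo.orbit_act intro!: bexI[of _ g])
next
  case (step x' x'')
  then obtain g where g: "g \<in> carrier G" "Cod K x' = Dom K (am g y)"
    "(Comp K x y, Comp K x' (am g y)) \<in> rel\<^sup>+" by blast
  have m: "x' \<in> Mor K" "x'' \<in> Mor K" using step unfolding mor_rel_def by auto
  obtain h where h: "h \<in> carrier G" "ao h (Cod K x') = Cod K x''"
    using rel_Dom_Cod[OF step(2)] m ob.orbit_eqD[of "Cod K x'" "Cod K x''"] Cod_closed by blast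
  interpret grp: group G using mo.group_hom group_hom.axioms(1) by blast
  have hg: "am (h \<otimes>\<^bsub>G\<^esub> g) y = am h (am g y)"
    using g h assms mo.composition_rule by blast
  have "(Comp K x' (am g y), Comp K x'' (am h (am g y))) \<in> rel"
    using rel_Comp[OF step(2) rel_orbit[of "am g y" "am h (am g y)"]] g h assms
    by (auto simp: act_Dom[OF h(1)] mo.orbit_act)
  moreover have "Cod K x'' = Dom K (am h (am g y))"
    using g h assms by (simp add: act_Dom[OF h(1)])
  ultimately show ?case
    using g h by (auto intro!: bexI[of _ "h \<otimes>\<^bsub>G\<^esub> g"] simp: hg)
qed

lemma trancl_Comp_right:
  assumes "(y, y') \<in> rel\<^sup>+" "x \<in> Mor K" "Cod K x = Dom K y"
  shows "\<exists>g \<in> carrier G. Cod K (am g x) = Dom K y' \<and> (Comp K x y, Comp K (am g x) y') \<in> rel\<^sup>+"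
  using assms(1)
proof (induction rule: trancl_induct)
  case (base y')
  have m: "y \<in> Mor K" "y' \<in> Mor K" using base unfolding mor_rel_def by auto
  obtain g where g: "g \<in> carrier G" "ao g (Dom K y) = Dom K y'"
    using rel_Dom_Cod[OF base] m ob.orbit_eqD[of "Dom K y" "Dom K y'"] Dom_closed by blast
  then show ?case
    using rel_Comp[OF rel_orbit[of x "am g x"] base] assms m
    by (auto simp: act_Cod mo.orbit_act intro!: bexI[of _ g])
next
  case (step y' y'')
  then obtain g where g: "g \<in> carrier G" "Cod K (am g x) = Dom K y'"
    "(Comp K x y, Comp K (am g x) y') \<in> rel\<^sup>+" by blast
  have m: "y' \<in> Mor K" "y'' \<in> Mor K" using step unfolding mor_rel_def by auto
  obtain h where h: "h \<in> carrier G" "ao h (Dom K y') = Dom K y''"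
    using rel_Dom_Cod[OF step(2)] m ob.orbit_eqD[of "Dom K y'" "Dom K y''"] Dom_closed by blast
  interpret grp: group G using mo.group_hom group_hom.axioms(1) by blast
  have hg: "am (h \<otimes>\<^bsub>G\<^esub> g) x = am h (am g x)"
    using g h assms mo.composition_rule by blast
  have "(Comp K (am g x) y', Comp K (am h (am g x)) y'') \<in> rel"
    using rel_Comp[OF rel_orbit[of "am g x" "am h (am g x)"] step(2)] g h assms
    by (auto simp: act_Cod[OF h(1)] mo.orbit_act)
  moreover have "Cod K (am h (am g x)) = Dom K y''"
    using g h assms by (simp add: act_Cod[OF h(1)])
  ultimately show ?case
    using g h by (auto intro!: bexI[of _ "h \<otimes>\<^bsub>G\<^esub> g"] simp: hg)
qed

lemma trancl_Comp:
  assumes "(x, x') \<in> rel\<^sup>+" "(y, y') \<in> rel\<^sup>+" "Cod K x = Dom K y" "Cod K x' = Dom K y'"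
  shows "(Comp K x y, Comp K x' y') \<in> rel\<^sup>+"
proof -
  have m: "x \<in> Mor K" "x' \<in> Mor K" "y \<in> Mor K" "y' \<in> Mor K" using assms rel_Mor by auto
  obtain g where g: "g \<in> carrier G" "Cod K x' = Dom K (am g y)"
    "(Comp K x y, Comp K x' (am g y)) \<in> rel\<^sup>+"
    using trancl_Comp_left[OF assms(1) m(3) assms(3)] by blast
  have gy: "(am g y, y') \<in> rel\<^sup>+"
    using g m assms(2) cls_act[OF g(1) m(3)] cls_eq_iff by (metis act_closed(2))
  obtain h where h: "h \<in> carrier G" "Cod K (am h x') = Dom K y'"
    "(Comp K x' (am g y), Comp K (am h x') y') \<in> rel\<^sup>+"
    using trancl_Comp_right[OF gy m(2) g(2)] by blast
  have "(Comp K (am h x') y', Comp K x' y') \<in> rel"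
    using rel_Comp[OF rel_orbit[of "am h x'" x'] rel_orbit[of y' y']] m h assms
    by (auto simp: mo.orbit_act)
  with g h show ?thesis by (meson r_into_trancl trancl_trans)
qed

lemma Comp_class:
  assumes "x \<in> Mor K" "y \<in> Mor K" "Cod K x = Dom K y"
  shows "Comp KG (cls x) (cls y) = cls (Comp K x y)"
proof -
  have "cls (Comp K x' y') = cls (Comp K x y)"
    if "x' \<in> cls x" "y' \<in> cls y" "Cod K x' = Dom K y'" for x' y'
    using that assms mem_cls trancl_Comp[of x x' y y'] cls_eq_iff[of "Comp K x y" "Comp K x' y'"]
    by (auto simp: Comp_closed)
  then have "{cls (Comp K x' y') | x' y'. x' \<in> cls x \<and> y' \<in> cls y \<and> Cod K x' = Dom K y'}
      = {cls (Comp K x y)}"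
    using assms cls_self by blast
  then show ?thesis by (simp add: quotient_cat_def)
qed

lemma lift_composable:
  assumes "x \<in> Mor K" "y \<in> Mor K" "Cod KG (cls x) = Dom KG (cls y)"
  obtains y' where "y' \<in> Mor K" "cls y' = cls y" "Cod K x = Dom K y'"
proof -
  have "orbit G ao (Dom K y) = orbit G ao (Cod K x)"
    using assms by (simp add: Dom_class Cod_class)
  then obtain g where "g \<in> carrier G" "ao g (Dom K y) = Cod K x"
    using ob.orbit_eqD[of "Dom K y" "Cod K x"] assms Dom_closed Cod_closed by blast
  then show thesis using assms by (intro that[of "am g y"]) (auto simp: act_Dom cls_act)
qed

lemma lift_pair:
  assumes "X \<in> Mor KG" "Y \<in> Mor KG" "Cod KG X = Dom KG Y"
  obtains x y where "x \<in> Mor K" "y \<in> Mor K" "X = cls x" "Y = cls y" "Cod K x = Dom K y"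
proof -
  obtain x y where xy: "x \<in> Mor K" "y \<in> Mor K" "X = cls x" "Y = cls y"
    using assms unfolding Mor_KG by auto
  then obtain y' where "y' \<in> Mor K" "cls y' = cls y" "Cod K x = Dom K y'"
    using lift_composable[of x y] assms by blast
  then show thesis using that xy by metis
qed

sublocale quotient: category KG
proof
  fix X Y assume XY: "X \<in> Mor KG" "Y \<in> Mor KG" "Cod KG X = Dom KG Y"
  then obtain x y where "x \<in> Mor K" "y \<in> Mor K" "X = cls x" "Y = cls y" "Cod K x = Dom K y"
    by (rule lift_pair)
  then show "Comp KG X Y \<in> Mor KG" "Dom KG (Comp KG X Y) = Dom KG X"
    "Cod KG (Comp KG X Y) = Cod KG Y"
    by (auto simp: Comp_class Mor_KG Dom_class Cod_class cat_simps)
next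
  fix X Y Z
  assume XYZ: "X \<in> Mor KG" "Y \<in> Mor KG" "Z \<in> Mor KG"
    "Cod KG X = Dom KG Y" "Cod KG Y = Dom KG Z"
  obtain x y where xy: "x \<in> Mor K" "y \<in> Mor K" "X = cls x" "Y = cls y" "Cod K x = Dom K y"
    using XYZ by (blast intro: lift_pair)
  obtain z where z: "z \<in> Mor K" "Z = cls z" "Cod K y = Dom K z"
    using lift_composable[OF xy(2)] XYZ xy unfolding Mor_KG by (metis imageE)
  show "Comp KG (Comp KG X Y) Z = Comp KG X (Comp KG Y Z)"
    using xy z by (simp add: Comp_class cat_simps Comp_assoc)
qed (auto simp: Mor_KG Obj_KG Dom_class Cod_class Ident_class Comp_class cat_simps)

lemma chain_KG:
  "chain K a ms \<Longrightarrow> chain KG (orbit G ao a) (map cls ms)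
    \<and> chain_end KG (orbit G ao a) (map cls ms) = orbit G ao (chain_end K a ms)
    \<and> chain_comp KG (orbit G ao a) (map cls ms) = cls (chain_comp K a ms)"
proof (induction ms arbitrary: a)
  case Nil
  then show ?case by (simp add: Obj_KG Ident_class)
next
  case (Cons m ms)
  then show ?case
    using chain_comp_props[of "Cod K m" ms]
    by (auto simp: Mor_KG Dom_class Cod_class Comp_class)
qed

lemma chain_KG_lift:
  assumes "chain KG (orbit G ao a) Ms" "a \<in> Obj K"
  shows "\<exists>ms. chain K a ms \<and> map cls ms = Ms"
  using assms
proof (induction Ms arbitrary: a)
  case (Cons M Ms)
  then obtain m where m: "m \<in> Mor K" "M = cls m" by (auto simp: Mor_KG)
  then obtain g where g: "g \<in> carrier G" "ao g (Dom K m) = a"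
    using ob.orbit_eqD[of "Dom K m" a] Cons.prems Dom_closed by (auto simp: Dom_class)
  have M: "M = cls (am g m)" using m g by (simp add: cls_act)
  obtain ms where "chain K (Cod K (am g m)) ms" "map cls ms = Ms"
    using Cons.IH[of "Cod K (am g m)"] Cons.prems M m g by (auto simp: Cod_class Cod_closed)
  then show ?case using m g M by (intro exI[of _ "am g m # ms"]) (auto simp: act_Dom)
qed auto

end

section \<open>Simplicial sets\<close>

text \<open>Simplicial sets are contravariant functors from the simplex category to sets.\<close>

definition simplex_maps :: "nat \<Rightarrow> nat \<Rightarrow> (nat \<Rightarrow> nat) set" where
  "simplex_maps m n = {\<theta> \<in> {..m} \<rightarrow>\<^sub>E {..n}. mono_on {..m} \<theta>}"

record 'x sset =
  simplices :: "nat \<Rightarrow> 'x set"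
  smap :: "nat \<Rightarrow> nat \<Rightarrow> (nat \<Rightarrow> nat) \<Rightarrow> 'x \<Rightarrow> 'x"
  \<comment> \<open>\<open>smap X m n \<theta>\<close> takes \<open>n\<close>-simplices to \<open>m\<close>-simplices, for \<open>\<theta> \<in> simplex_maps m n\<close>\<close>

locale simplicial_set =
  fixes X :: "'x sset"
  assumes smap_closed: "\<lbrakk>\<theta> \<in> simplex_maps m n; x \<in> simplices X n\<rbrakk> \<Longrightarrow> smap X m n \<theta> x \<in> simplices X m"
    and smap_id: "x \<in> simplices X n \<Longrightarrow> smap X n n (\<lambda>i \<in> {..n}. i) x = x"
    and smap_comp: "\<lbrakk>\<eta> \<in> simplex_maps k m; \<theta> \<in> simplex_maps m n; x \<in> simplices X n\<rbrakk>
      \<Longrightarrow> smap X k m \<eta> (smap X m n \<theta> x) = smap X k n (compose {..k} \<theta> \<eta>) x"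

text \<open>The \<open>d\<close>-skeleton is the simplicial subset generated by the simplices of dimension at
  most \<open>d\<close>; it has (degenerate) simplices in every dimension.\<close>

definition skeleton :: "nat \<Rightarrow> 'x sset \<Rightarrow> 'x sset" where
  "skeleton d X = X\<lparr>simplices := (\<lambda>n. {smap X n s \<theta> y | s \<theta> y.
      s \<le> d \<and> \<theta> \<in> simplex_maps n s \<and> y \<in> simplices X s})\<rparr>"

text \<open>A \<open>t\<close>-simplex of the nerve is a chain of \<open>t\<close> composable morphisms together with its
  starting object, which carries information only for \<open>t = 0\<close>. The \<open>i\<close>-th morphism
  of its image under \<open>\<theta>\<close> is the composite of the morphisms between the vertices \<open>\<theta> i\<close>
  and \<open>\<theta> (i + 1)\<close>.\<close>

definition nerve :: "('o, 'm) cat \<Rightarrow> ('o \<times> 'm list) sset" where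
  "nerve K =
    \<lparr>simplices = (\<lambda>t. {(a, ms). length ms = t \<and> chain K a ms}),
     smap = (\<lambda>m n \<theta> (a, ms).
       (chain_end K a (take (\<theta> 0) ms),
        map (\<lambda>i. chain_comp K (chain_end K a (take (\<theta> i) ms)) (drop (\<theta> i) (take (\<theta> (Suc i)) ms)))
          [0..<m]))\<rparr>"

definition nerve_act :: "('g \<Rightarrow> 'o \<Rightarrow> 'o) \<Rightarrow> ('g \<Rightarrow> 'm \<Rightarrow> 'm) \<Rightarrow> 'g \<Rightarrow> 'o \<times> 'm list \<Rightarrow> 'o \<times> 'm list" where
  "nerve_act ao am g = (\<lambda>(a, ms). (ao g a, map (am g) ms))"

text \<open>For an action by simplicial maps, the image of an orbit under a structure map of \<open>X\<close>
  is again an orbit.\<close>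

definition quotient_sset :: "('g, 'b) monoid_scheme \<Rightarrow> 'x sset \<Rightarrow> ('g \<Rightarrow> 'x \<Rightarrow> 'x) \<Rightarrow> 'x set sset" where
  "quotient_sset G X \<phi> =
    \<lparr>simplices = (\<lambda>t. orbits G (simplices X t) \<phi>),
     smap = (\<lambda>m n \<theta> A. smap X m n \<theta> ` A)\<rparr>"

definition canonical_map ::
  "('g, 'b) monoid_scheme \<Rightarrow> ('o, 'm) cat \<Rightarrow> ('g \<Rightarrow> 'o \<Rightarrow> 'o) \<Rightarrow> ('g \<Rightarrow> 'm \<Rightarrow> 'm)
    \<Rightarrow> ('o \<times> 'm list) set \<Rightarrow> 'o set \<times> 'm set list" where
  "canonical_map G K ao am A =
    the_elem ((\<lambda>(a, ms). (orbit G ao a, map (mor_class G K am) ms)) ` A)"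

subsection \<open>The nerve is a simplicial set\<close>

lemma simplex_mapsD:
  assumes "\<theta> \<in> simplex_maps m n"
  shows "i \<le> m \<Longrightarrow> \<theta> i \<le> n" "\<lbrakk>i \<le> j; j \<le> m\<rbrakk> \<Longrightarrow> \<theta> i \<le> \<theta> j"
  using assms by (auto simp: simplex_maps_def mono_on_def PiE_def Pi_def)

context category
begin

abbreviation vertex :: "'o \<Rightarrow> 'm list \<Rightarrow> nat \<Rightarrow> 'o" where
  "vertex a ms i \<equiv> chain_end K a (take i ms)"

abbreviation edge :: "'o \<Rightarrow> 'm list \<Rightarrow> nat \<Rightarrow> nat \<Rightarrow> 'm" where
  "edge a ms i j \<equiv> chain_comp K (vertex a ms i) (drop i (take j ms))"

lemma take_split: "i \<le> j \<Longrightarrow> take j ms = take i ms @ drop i (take j ms)"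
  by (metis append_take_drop_id min.absorb1 take_take)

lemma chain_take: "chain K a ms \<Longrightarrow> chain K a (take i ms)"
  by (metis append_take_drop_id chain_append)

lemma chain_segment:
  assumes "chain K a ms" "i \<le> j"
  shows "chain K (vertex a ms i) (drop i (take j ms))"
    and "chain_end K (vertex a ms i) (drop i (take j ms)) = vertex a ms j"
  using chain_take[OF assms(1), of j] take_split[OF assms(2), of ms]
  by (metis chain_append, metis chain_end_append)

lemma edge_trans:
  assumes "chain K a ms" "i \<le> j" "j \<le> k" "k \<le> length ms"
  shows "edge a ms i k = Comp K (edge a ms i j) (edge a ms j k)"
proof -
  have "drop i (take k ms) = drop i (take j ms) @ drop j (take k ms)"
    using assms by (subst take_split[of j k]) auto
  then show ?thesis
    using chain_comp_append chain_segment assms by metis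
qed

lemma chain_edges:
  assumes ch: "chain K a ms" and \<theta>: "\<theta> \<in> simplex_maps m (length ms)" and pq: "p \<le> q" "q \<le> m"
  shows "chain K (vertex a ms (\<theta> p)) (map (\<lambda>i. edge a ms (\<theta> i) (\<theta> (Suc i))) [p..<q])
    \<and> chain_end K (vertex a ms (\<theta> p)) (map (\<lambda>i. edge a ms (\<theta> i) (\<theta> (Suc i))) [p..<q])
        = vertex a ms (\<theta> q)
    \<and> chain_comp K (vertex a ms (\<theta> p)) (map (\<lambda>i. edge a ms (\<theta> i) (\<theta> (Suc i))) [p..<q])
        = edge a ms (\<theta> p) (\<theta> q)"
  using pq
proof (induction q rule: dec_induct)
  case base
  then show ?case using chain_end_closed chain_take ch by simp
next
  case (step q)
  have le: "\<theta> p \<le> \<theta> q" "\<theta> q \<le> \<theta> (Suc q)" "\<theta> (Suc q) \<le> length ms"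
    using step simplex_mapsD[OF \<theta>] by auto
  have e: "edge a ms (\<theta> q) (\<theta> (Suc q)) \<in> Mor K"
    "Dom K (edge a ms (\<theta> q) (\<theta> (Suc q))) = vertex a ms (\<theta> q)"
    "Cod K (edge a ms (\<theta> q) (\<theta> (Suc q))) = vertex a ms (\<theta> (Suc q))"
    using chain_comp_props chain_segment[OF ch le(2)] by metis+
  have v: "vertex a ms (\<theta> (Suc q)) \<in> Obj K"
    using chain_end_closed chain_take ch by blast
  have c1: "chain_comp K (vertex a ms (\<theta> q)) [edge a ms (\<theta> q) (\<theta> (Suc q))]
      = edge a ms (\<theta> q) (\<theta> (Suc q))"
    using Comp_Ident[OF e(1)] e by simp
  have c2: "chain K (vertex a ms (\<theta> q)) [edge a ms (\<theta> q) (\<theta> (Suc q))]"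
    using e v by simp
  show ?case
    using step e v c2 edge_trans[OF ch le]
    by (simp add: chain_append chain_end_append chain_comp_append c1 del: chain_comp.simps)
qed

lemma nerve_smap:
  "smap (nerve K) m n \<theta> (a, ms) =
    (vertex a ms (\<theta> 0), map (\<lambda>i. edge a ms (\<theta> i) (\<theta> (Suc i))) [0..<m])"
  by (simp add: nerve_def)

lemma simplicial_set_nerve: "simplicial_set (nerve K)"
proof
  fix \<theta> m n x
  assume "\<theta> \<in> simplex_maps m n" "x \<in> simplices (nerve K) n"
  then show "smap (nerve K) m n \<theta> x \<in> simplices (nerve K) m"
    using chain_edges[of _ _ \<theta> m 0 m] by (cases x) (auto simp: nerve_def)
next
  fix x n
  assume x: "x \<in> simplices (nerve K) n"
  obtain a ms where [simp]: "x = (a, ms)" by (cases x)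
  have ch: "chain K a ms" and [simp]: "length ms = n" using x by (auto simp: nerve_def)
  have "edge a ms i (Suc i) = ms ! i" if "i < n" for i
  proof -
    have d: "drop i (take (Suc i) ms) = [ms ! i]"
      using that by (simp add: take_Suc_conv_app_nth)
    then show ?thesis using chain_segment(1)[OF ch, of i "Suc i"] Comp_Ident by auto
  qed
  then show "smap (nerve K) n n (\<lambda>i \<in> {..n}. i) x = x"
    by (auto simp: nerve_smap intro!: nth_equalityI)
next
  fix \<eta> k m \<theta> n x
  assume \<eta>: "\<eta> \<in> simplex_maps k m" and \<theta>: "\<theta> \<in> simplex_maps m n"
    and x: "x \<in> simplices (nerve K) n"
  obtain a ms where [simp]: "x = (a, ms)" by (cases x)
  have ch: "chain K a ms" and [simp]: "length ms = n" using x by (auto simp: nerve_def)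
  have v: "vertex (vertex a ms (\<theta> 0)) (map (\<lambda>i. edge a ms (\<theta> i) (\<theta> (Suc i))) [0..<m]) (\<eta> i)
      = vertex a ms (\<theta> (\<eta> i))" if "i \<le> k" for i
    using that simplex_mapsD(1)[OF \<eta>, of i] chain_edges[OF ch, of \<theta> m 0 "\<eta> i"] \<theta>
    by (simp add: take_map)
  have e: "chain_comp K (vertex a ms (\<theta> (\<eta> i)))
      (drop (\<eta> i) (take (\<eta> (Suc i)) (map (\<lambda>i. edge a ms (\<theta> i) (\<theta> (Suc i))) [0..<m])))
      = edge a ms (\<theta> (\<eta> i)) (\<theta> (\<eta> (Suc i)))" if "i < k" for i
    using that simplex_mapsD[OF \<eta>] chain_edges[OF ch, of \<theta> m "\<eta> i" "\<eta> (Suc i)"] \<theta>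
    by (simp add: take_map drop_map)
  show "smap (nerve K) k m \<eta> (smap (nerve K) m n \<theta> x)
      = smap (nerve K) k n (compose {..k} \<theta> \<eta>) x"
    by (auto simp: nerve_smap compose_def v e)
qed

end

subsection \<open>The quotient simplicial set and the canonical map\<close>

context category_action
begin

abbreviation "nact \<equiv> nerve_act ao am"
abbreviation "NKG \<equiv> quotient_sset G (nerve K) nact"

lemma chain_act:
  "\<lbrakk>g \<in> carrier G; chain K a ms\<rbrakk> \<Longrightarrow> chain K (ao g a) (map (am g) ms)
    \<and> chain_end K (ao g a) (map (am g) ms) = ao g (chain_end K a ms)
    \<and> chain_comp K (ao g a) (map (am g) ms) = am g (chain_comp K a ms)"
proof (induction ms arbitrary: a)
  case (Cons m ms)
  then show ?case
    using chain_comp_props[of "Cod K m" ms] by (auto simp: act_Dom act_Cod act_Comp)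
qed (auto simp: act_Ident)

lemma nact_closed:
  "\<lbrakk>g \<in> carrier G; x \<in> simplices (nerve K) n\<rbrakk> \<Longrightarrow> nact g x \<in> simplices (nerve K) n"
  using chain_act by (auto simp: nerve_def nerve_act_def)

lemma nact_smap:
  assumes "g \<in> carrier G" "\<theta> \<in> simplex_maps m n" "x \<in> simplices (nerve K) n"
  shows "smap (nerve K) m n \<theta> (nact g x) = nact g (smap (nerve K) m n \<theta> x)"
proof -
  obtain a ms where x: "x = (a, ms)" by (cases x)
  have ch: "chain K a ms" using assms x by (auto simp: nerve_def)
  have v: "vertex (ao g a) (map (am g) ms) i = ao g (vertex a ms i)" for i
    using chain_act[OF assms(1) chain_take[OF ch]] by (simp add: take_map)
  have e: "chain_comp K (ao g (vertex a ms (\<theta> i)))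
      (drop (\<theta> i) (take (\<theta> (Suc i)) (map (am g) ms))) = am g (edge a ms (\<theta> i) (\<theta> (Suc i)))"
    if "i < m" for i
    using chain_act[OF assms(1) chain_segment(1)[OF ch simplex_mapsD(2)[OF assms(2)]], of i "Suc i"]
      that
    by (simp add: take_map drop_map)
  show ?thesis by (auto simp: x nerve_smap nerve_act_def v e)
qed

lemma simplices_NKG: "simplices NKG n = orbit G nact ` simplices (nerve K) n"
  by (auto simp: quotient_sset_def orbits_def)

lemma smap_orbit:
  assumes "\<theta> \<in> simplex_maps m n" "x \<in> simplices (nerve K) n"
  shows "smap NKG m n \<theta> (orbit G nact x) = orbit G nact (smap (nerve K) m n \<theta> x)"
proof -
  have orb: "orbit G nact z = (\<lambda>g. nact g z) ` carrier G" for z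
    by (auto simp: orbit_def)
  have "smap (nerve K) m n \<theta> ` orbit G nact x = orbit G nact (smap (nerve K) m n \<theta> x)"
    unfolding orb image_image by (intro image_cong refl nact_smap assms)
  then show ?thesis by (simp add: quotient_sset_def)
qed

lemma nact_one:
  assumes "x \<in> simplices (nerve K) n"
  shows "nact \<one>\<^bsub>G\<^esub> x = x"
proof -
  obtain a ms where x: "x = (a, ms)" and ch: "chain K a ms"
    using assms by (auto simp: nerve_def)
  have mo: "am \<one>\<^bsub>G\<^esub> y = y" if "y \<in> Mor K" for y
    using that mo.id_eq_one by (metis restrict_apply')
  have ob: "ao \<one>\<^bsub>G\<^esub> b = b" if "b \<in> Obj K" for b
    using that ob.id_eq_one by (metis restrict_apply')
  have "map (am \<one>\<^bsub>G\<^esub>) ms = ms"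
    using ch by (induction ms arbitrary: a) (auto simp: mo)
  then show ?thesis
    using ob[OF chain_start[OF ch]] by (simp add: x nerve_act_def)
qed

lemma nact_orbit_refl:
  assumes "x \<in> simplices (nerve K) n"
  shows "x \<in> orbit G nact x"
proof -
  interpret grp: group G using mo.group_hom group_hom.axioms(1) by blast
  show ?thesis
    unfolding orbit_def mem_Collect_eq
    using nact_one[OF assms, symmetric] grp.one_closed by blast
qed

lemma simplicial_set_quotient: "simplicial_set NKG"
proof -
  interpret N: simplicial_set "nerve K" by (rule simplicial_set_nerve)
  have c: "compose {..k} \<theta> \<eta> \<in> simplex_maps k n"
    if "\<eta> \<in> simplex_maps k m" "\<theta> \<in> simplex_maps m n" for \<eta> k m \<theta> n
    using that simplex_mapsD[OF that(1)] simplex_mapsD[OF that(2)]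
    by (auto simp: simplex_maps_def compose_def mono_on_def)
  have i: "(\<lambda>i \<in> {..n}. i) \<in> simplex_maps n n" for n
    by (auto simp: simplex_maps_def mono_on_def)
  show ?thesis
  proof
    fix \<theta> m n A assume \<theta>: "\<theta> \<in> simplex_maps m n" and "A \<in> simplices NKG n"
    then obtain x where x: "x \<in> simplices (nerve K) n" "A = orbit G nact x"
      unfolding simplices_NKG by blast
    show "smap NKG m n \<theta> A \<in> simplices NKG m"
      using N.smap_closed[OF \<theta> x(1)] unfolding x(2) smap_orbit[OF \<theta> x(1)] simplices_NKG by blast
  next
    fix A n assume "A \<in> simplices NKG n"
    then obtain x where x: "x \<in> simplices (nerve K) n" "A = orbit G nact x"
      unfolding simplices_NKG by blast
    show "smap NKG n n (\<lambda>i \<in> {..n}. i) A = A"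
      unfolding x(2) smap_orbit[OF i x(1)] N.smap_id[OF x(1)] ..
  next
    fix \<eta> k m \<theta> n A
    assume \<eta>: "\<eta> \<in> simplex_maps k m" and \<theta>: "\<theta> \<in> simplex_maps m n" and "A \<in> simplices NKG n"
    then obtain x where x: "x \<in> simplices (nerve K) n" "A = orbit G nact x"
      unfolding simplices_NKG by blast
    show "smap NKG k m \<eta> (smap NKG m n \<theta> A) = smap NKG k n (compose {..k} \<theta> \<eta>) A"
      unfolding x(2) smap_orbit[OF \<theta> x(1)] smap_orbit[OF \<eta> N.smap_closed[OF \<theta> x(1)]]
        smap_orbit[OF c[OF \<eta> \<theta>] x(1)] N.smap_comp[OF \<eta> \<theta> x(1)] ..
  qed
qed

lemma canonical_map_orbit:
  assumes "(a, ms) \<in> simplices (nerve K) n"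
  shows "canonical_map G K ao am (orbit G nact (a, ms)) = (orbit G ao a, map cls ms)"
proof -
  have Mor: "set ms' \<subseteq> Mor K" if "chain K b ms'" for b ms'
    using that by (induction ms' arbitrary: b) auto
  have ch: "chain K a ms" using assms by (simp add: nerve_def)
  let ?f = "\<lambda>(b, ns). (orbit G ao b, map cls ns)"
  have f: "?f (nact g (a, ms)) = (orbit G ao a, map cls ms)" if "g \<in> carrier G" for g
    using that Mor[OF ch] chain_start[OF ch]
    by (auto simp: nerve_act_def ob.orbit_act intro!: cls_act)
  have "?f x = ?f (a, ms)" if "x \<in> orbit G nact (a, ms)" for x
    using that f unfolding orbit_def by auto
  then have "the_elem (?f ` orbit G nact (a, ms)) = ?f (a, ms)"
    using nact_orbit_refl[OF assms] by (intro the_elem_image_unique) blast+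
  then show ?thesis by (simp add: canonical_map_def)
qed

lemma canonical_map_surj:
  "canonical_map G K ao am ` simplices NKG n = simplices (nerve KG) n"
proof (intro equalityI subsetI)
  fix y assume "y \<in> canonical_map G K ao am ` simplices NKG n"
  then show "y \<in> simplices (nerve KG) n"
    unfolding simplices_NKG using chain_KG canonical_map_orbit
    by (auto simp: nerve_def)
next
  fix y assume "y \<in> simplices (nerve KG) n"
  then obtain A Ms where y: "y = (A, Ms)" "length Ms = n" "chain KG A Ms"
    by (auto simp: nerve_def)
  then obtain a where a: "a \<in> Obj K" "A = orbit G ao a"
    using quotient.chain_start Obj_KG by blast
  then obtain ms where ms: "chain K a ms" "map cls ms = Ms" using chain_KG_lift y by blast
  then have s: "(a, ms) \<in> simplices (nerve K) n" using y by (auto simp: nerve_def)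
  have "y = canonical_map G K ao am (orbit G nact (a, ms))"
    using canonical_map_orbit[OF s] y a ms by simp
  then show "y \<in> canonical_map G K ao am ` simplices NKG n"
    unfolding simplices_NKG using s by blast
qed

lemma canonical_map_natural:
  assumes "\<theta> \<in> simplex_maps m n" "A \<in> simplices NKG n"
  shows "canonical_map G K ao am (smap NKG m n \<theta> A)
    = smap (nerve KG) m n \<theta> (canonical_map G K ao am A)"
proof -
  interpret N: simplicial_set "nerve K" by (rule simplicial_set_nerve)
  obtain a ms where s: "(a, ms) \<in> simplices (nerve K) n" and A: "A = orbit G nact (a, ms)"
    using assms(2) unfolding simplices_NKG by auto
  have ch: "chain K a ms" using s by (simp add: nerve_def)
  have v: "chain_end KG (orbit G ao a) (take i (map cls ms)) = orbit G ao (vertex a ms i)" for i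
    using chain_KG[OF chain_take[OF ch]] by (simp add: take_map)
  have e: "chain_comp KG (orbit G ao (vertex a ms (\<theta> i)))
      (drop (\<theta> i) (take (\<theta> (Suc i)) (map cls ms))) = cls (edge a ms (\<theta> i) (\<theta> (Suc i)))"
    if "i < m" for i
    using chain_KG[OF chain_segment(1)[OF ch simplex_mapsD(2)[OF assms(1)]], of i "Suc i"]
      that
    by (simp add: take_map drop_map)
  have "canonical_map G K ao am (smap NKG m n \<theta> A)
      = (\<lambda>(b, ns). (orbit G ao b, map cls ns)) (smap (nerve K) m n \<theta> (a, ms))"
    using canonical_map_orbit N.smap_closed[OF assms(1) s] smap_orbit[OF assms(1) s] A
    by (metis (no_types, lifting) case_prod_conv surj_pair)
  also have "\<dots> = smap (nerve KG) m n \<theta> (orbit G ao a, map cls ms)"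
    by (auto simp: nerve_smap quotient.nerve_smap v e)
  finally show ?thesis using canonical_map_orbit[OF s] A by simp
qed

end

end

theory Submission
  imports Defs
begin

text \<open>Under Condition (R), two composites with factorwise equal orbits lie in the same orbit:
  move the first factors onto each other by a group element and apply (R) to the remaining
  composites. So the classes \<open>[x]\<close> are orbits, which is injectivity on \<open>1\<close>-simplices. In
  the \<open>1\<close>-skeleton a chain has at most one factor that is not an identity; a group element
  carrying that factor to its counterpart carries the whole chain along. Conversely,
  \<open>[x \<circ> ya] = [x \<circ> yb]\<close> whenever \<open>ya\<close> and \<open>yb\<close> are in the same orbit.\<close>

context category_action
begin

section \<open>Action laws for simplices of the nerve\<close>

lemma nact_mult:
  assumes "g \<in> carrier G" "h \<in> carrier G" "x \<in> simplices (nerve K) n"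
  shows "nact (h \<otimes>\<^bsub>G\<^esub> g) x = nact h (nact g x)"
proof -
  obtain a ms where x: "x = (a, ms)" "chain K a ms"
    using assms(3) by (auto simp: nerve_def)
  have "map (am (h \<otimes>\<^bsub>G\<^esub> g)) ms = map (am h) (map (am g) ms)"
    using x(2) by (induction ms arbitrary: a) (auto simp: mo.composition_rule assms)
  then show ?thesis
    using chain_start[OF x(2)] assms by (simp add: x nerve_act_def ob.composition_rule)
qed

text \<open>Moving the base simplex can only shrink its orbit; using this for \<open>g\<close> and
  then for its inverse gives both inclusions.\<close>

lemma orbit_nact:
  assumes g: "g \<in> carrier G" and x: "x \<in> simplices (nerve K) n"
  shows "orbit G nact (nact g x) = orbit G nact x"
proof -
  interpret grp: group G using mo.group_hom group_hom.axioms(1) by blast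
  have sub: "orbit G nact (nact h z) \<subseteq> orbit G nact z"
    if "h \<in> carrier G" "z \<in> simplices (nerve K) n" for h z
  proof
    fix y assume "y \<in> orbit G nact (nact h z)"
    then obtain k where k: "k \<in> carrier G" "y = nact k (nact h z)" by (auto simp: orbit_def)
    then show "y \<in> orbit G nact z"
      using nact_mult[OF that(1) k(1) that(2)] grp.m_closed[OF k(1) that(1)]
      unfolding orbit_def by force
  qed
  have "nact (inv\<^bsub>G\<^esub> g) (nact g x) = x"
    using nact_mult[OF g grp.inv_closed[OF g] x] nact_one[OF x] grp.l_inv[OF g] by simp
  then show ?thesis
    using sub[OF g x] sub[OF grp.inv_closed[OF g] nact_closed[OF g x]] by auto
qed

section \<open>Chains with at most one non-identity factor\<close>

abbreviation "idents \<equiv> Ident K ` Obj K"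

lemma idents_cong:
  assumes "x \<in> Mor K" "y \<in> Mor K" "orbit G am x = orbit G am y" "x \<in> idents"
  shows "y \<in> idents"
proof -
  obtain g where "g \<in> carrier G" "am g x = y" using mo.orbit_eqD[OF assms(1-3)] .
  then show ?thesis using assms(4) act_Ident[of g] by auto
qed

lemma ident_of_Dom: "x \<in> idents \<Longrightarrow> x = Ident K (Dom K x) \<and> Cod K x = Dom K x"
  by (auto simp: Dom_Ident Cod_Ident)

text \<open>A chain of identities never leaves its starting object, so its start and length
  determine it. The orbit relation passes both the length and being identities on to
  \<open>ns\<close>.\<close>

lemma map_act_idents:
  assumes "g \<in> carrier G" "chain K a ms" "chain K (ao g a) ns"
    "set ms \<subseteq> idents" "list_all2 (\<lambda>u v. orbit G am u = orbit G am v) ms ns"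
  shows "map (am g) ms = ns"
  using assms(2-5)
proof (induction ms arbitrary: ns)
  case (Cons m ms)
  then obtain n ns' where ns: "ns = n # ns'" by (cases ns) auto
  have n: "n \<in> idents" using idents_cong[of m n] Cons.prems ns by auto
  have ends: "Cod K m = a" "Cod K n = ao g a" and eqs: "m = Ident K a" "n = Ident K (ao g a)"
    using ident_of_Dom[of m] ident_of_Dom[OF n] Cons.prems ns by auto
  have "a \<in> Obj K" using chain_start Cons.prems by blast
  then have "am g m = n" using eqs act_Ident assms(1) by simp
  moreover have "map (am g) ms = ns'" using Cons.IH[of ns'] Cons.prems ns ends by simp
  ultimately show ?case using ns by simp
qed simp

text \<open>Factorwise equality of orbits gives one group element per factor, possibly all
  different. With a single non-identity factor they can be made to agree: an element matching that
  factor also matches its endpoints, hence the identities on either side.\<close>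

lemma act_chain_single_nonident:
  assumes "chain K a ms" "chain K b ns" "orbit G ao a = orbit G ao b"
    "list_all2 (\<lambda>u v. orbit G am u = orbit G am v) ms ns"
    "length (filter (\<lambda>m. m \<notin> idents) ms) \<le> 1"
  shows "\<exists>g \<in> carrier G. ao g a = b \<and> map (am g) ms = ns"
  using assms
proof (induction ms arbitrary: ns)
  case Nil
  \<comment> \<open>With no non-identity factor, the orbits of the starting objects supply the
    element.\<close>
  then show ?case using ob.orbit_eqD[of a b] by auto
next
  case (Cons m ms)
  then obtain n ns' where ns: "ns = n # ns'" by (cases ns) auto
  have mn: "m \<in> Mor K" "n \<in> Mor K" "orbit G am m = orbit G am n" "Dom K m = a" "Dom K n = b"
    using Cons.prems ns by auto
  show ?case
  proof (cases "m \<in> idents")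
    case True
    then have n: "n \<in> idents" using idents_cong[OF mn(1-3)] by blast
    \<comment> \<open>Leading identities keep both starting objects, so \<open>a\<close> and
      \<open>b\<close> can stay fixed in the induction.\<close>
    have eqs: "m = Ident K a" "Cod K m = a" "n = Ident K b" "Cod K n = b"
      using ident_of_Dom[OF True] ident_of_Dom[OF n] mn by auto
    then obtain g where "g \<in> carrier G" "ao g a = b" "map (am g) ms = ns'"
      using Cons.IH[of ns'] Cons.prems ns True by auto
    moreover have "a \<in> Obj K" using Dom_closed mn by blast
    ultimately show ?thesis using eqs act_Ident ns by auto
  next
    case False
    then have idents: "set ms \<subseteq> idents"
      using Cons.prems by (auto simp: filter_empty_conv)
    obtain g where g: "g \<in> carrier G" "am g m = n" using mo.orbit_eqD[OF mn(1-3)] .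
    have "map (am g) ms = ns'"
      using map_act_idents[OF g(1) _ _ idents, of "Cod K m" ns'] Cons.prems ns g
        act_Cod[OF g(1) mn(1)] by simp
    then show ?thesis using g mn ns act_Dom[OF g(1) mn(1)] by auto
  qed
qed

section \<open>Simplices of the 1-skeleton\<close>

lemma simplices_skeleton:
  "simplices (skeleton d X) n = {smap X n s \<theta> y | s \<theta> y.
    s \<le> d \<and> \<theta> \<in> simplex_maps n s \<and> y \<in> simplices X s}"
  by (simp add: skeleton_def)

text \<open>Such a simplex is pulled back from a vertex or an edge along a monotone map with values
  in {0, 1}. The map jumps at most once, and every step without a jump contributes an
  identity.\<close>

lemma skeleton_1_NKG:
  assumes "A \<in> simplices (skeleton 1 NKG) t"
  obtains a ms where "(a, ms) \<in> simplices (nerve K) t" "A = orbit G nact (a, ms)"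
    "length (filter (\<lambda>m. m \<notin> idents) ms) \<le> 1"
proof -
  interpret N: simplicial_set "nerve K" by (rule simplicial_set_nerve)
  obtain s \<theta> b ns where s: "s \<le> 1" and \<theta>: "\<theta> \<in> simplex_maps t s"
    and ns: "(b, ns) \<in> simplices (nerve K) s"
    and A: "A = orbit G nact (smap (nerve K) t s \<theta> (b, ns))"
  proof -
    obtain s \<theta> B where s: "s \<le> 1" "\<theta> \<in> simplex_maps t s" "B \<in> simplices NKG s"
      and A: "A = smap NKG t s \<theta> B"
      using assms unfolding simplices_skeleton by blast
    obtain b ns where "(b, ns) \<in> simplices (nerve K) s" "B = orbit G nact (b, ns)"
      using s(3) unfolding simplices_NKG by auto
    then show thesis using that[OF s(1,2)] smap_orbit[OF s(2)] A by simp
  qed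
  define e where "e i = edge b ns (\<theta> i) (\<theta> (Suc i))" for i
  have sm: "smap (nerve K) t s \<theta> (b, ns) = (vertex b ns (\<theta> 0), map e [0..<t])"
    by (simp add: nerve_smap e_def)
  have "vertex b ns i \<in> Obj K" for i
    using ns chain_take chain_end_closed by (auto simp: nerve_def)
  \<comment> \<open>Equal values cut out the empty segment, whose composite is an identity.\<close>
  then have "\<theta> i \<noteq> \<theta> (Suc i)" if "e i \<notin> idents" for i
    using that by (auto simp: e_def)
  then have jump: "\<theta> i = 0 \<and> \<theta> (Suc i) = 1" if "i < t" "e i \<notin> idents" for i
    using that s simplex_mapsD(1)[OF \<theta>, of "Suc i"] simplex_mapsD(2)[OF \<theta>, of i "Suc i"]
    by fastforce
  \<comment> \<open>After a jump the value is already 1, so by monotonicity no later jump can start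
    from 0.\<close>
  have "i = j" if "i < t" "e i \<notin> idents" "j < t" "e j \<notin> idents" for i j
    using jump[OF that(1,2)] jump[OF that(3,4)] that
      simplex_mapsD(2)[OF \<theta>, of "Suc i" j] simplex_mapsD(2)[OF \<theta>, of "Suc j" i]
    by (cases i j rule: linorder_cases) auto
  then have "card {i. i < t \<and> e i \<notin> idents} \<le> 1"
    using card_le_Suc0_iff_eq[of "{i. i < t \<and> e i \<notin> idents}"] by auto
  moreover have "{i. i < length (map e [0..<t]) \<and> map e [0..<t] ! i \<notin> idents}
      = {i. i < t \<and> e i \<notin> idents}" by auto
  ultimately show thesis
    using N.smap_closed[OF \<theta> ns] A unfolding sm
    by (intro that[of "vertex b ns (\<theta> 0)" "map e [0..<t]"]) (simp_all add: length_filter_conv_card)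
qed

section \<open>Morphism classes under Condition (R)\<close>

text \<open>Empty chains are excluded because their composites would be identities at the unrelated
  objects \<open>a\<close> and \<open>b\<close>.\<close>

lemma condition_R_chain_comp:
  assumes "condition_R G K am" "xs \<noteq> []" "chain K a xs" "chain K b ys"
    "list_all2 (\<lambda>u v. orbit G am u = orbit G am v) xs ys"
  shows "orbit G am (chain_comp K a xs) = orbit G am (chain_comp K b ys)"
  using assms(2-)
proof (induction xs arbitrary: a b ys)
  case (Cons x xs)
  then obtain y ys' where ys: "ys = y # ys'" by (cases ys) auto
  have xy: "x \<in> Mor K" "y \<in> Mor K" "orbit G am x = orbit G am y"
    and ch: "chain K (Cod K x) xs" "chain K (Cod K y) ys'"
    and l: "list_all2 (\<lambda>u v. orbit G am u = orbit G am v) xs ys'"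
    using Cons.prems ys by auto
  show ?case
  proof (cases "xs = []")
    case True
    then show ?thesis using l ys xy by (simp add: Comp_Ident)
  next
    case False
    define X where "X = chain_comp K (Cod K x) xs"
    define Y where "Y = chain_comp K (Cod K y) ys'"
    have XY: "X \<in> Mor K" "Dom K X = Cod K x" "Y \<in> Mor K" "Dom K Y = Cod K y"
      using chain_comp_props[OF ch(1)] chain_comp_props[OF ch(2)] by (auto simp: X_def Y_def)
    \<comment> \<open>Once \<open>g\<close> has aligned the first factors, \<open>am g X\<close> and
      \<open>Y\<close> both start at \<open>Cod K y\<close>, so (R) applies with \<open>y\<close> as
      the common first factor.\<close>
    obtain g where g: "g \<in> carrier G" "am g x = y" using mo.orbit_eqD[OF xy] .
    have gX: "am g X \<in> Mor K" "Dom K (am g X) = Cod K y"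
      using g XY xy act_Cod[OF g(1) xy(1)] by (auto simp: act_Dom)
    have "orbit G am (Comp K x X) = orbit G am (am g (Comp K x X))"
      using mo.orbit_act g XY xy Comp_closed by simp
    also have "\<dots> = orbit G am (Comp K y (am g X))"
      using act_Comp[OF g(1) xy(1) XY(1)] XY g by simp
    also have "\<dots> = orbit G am (Comp K y Y)"
    proof -
      have "orbit G am (am g X) = orbit G am Y"
        using Cons.IH[OF False ch l] mo.orbit_act[OF XY(1) g(1)] by (simp add: X_def Y_def)
      then show ?thesis
        using assms(1)[unfolded condition_R_def, rule_format, OF xy(2) gX(1) XY(3)]
          gX(2)[symmetric] XY(4)[symmetric] by blast
    qed
    finally show ?thesis by (simp add: ys X_def Y_def)
  qed
qed simp

text \<open>Directly related morphisms already share an orbit, and equality of orbits is transitive,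
  so the transitive closure merges nothing further.\<close>

lemma condition_R_cls:
  assumes "condition_R G K am" "x \<in> Mor K" "y \<in> Mor K" "cls x = cls y"
  shows "orbit G am x = orbit G am y"
proof -
  have rel: "orbit G am u = orbit G am v" if "(u, v) \<in> rel" for u v
    using that condition_R_chain_comp[OF assms(1)]
    unfolding mor_rel_def decomposition_def by fastforce
  have "(x, y) \<in> rel\<^sup>+" using cls_eq_iff assms by blast
  then show ?thesis by (induction rule: trancl_induct) (auto dest: rel)
qed

section \<open>The two implications\<close>

lemma condition_R_imp_inj_on:
  assumes "condition_R G K am"
  shows "inj_on (canonical_map G K ao am) (simplices (skeleton 1 NKG) t)"
proof (rule inj_onI)
  fix A B assume A: "A \<in> simplices (skeleton 1 NKG) t" and B: "B \<in> simplices (skeleton 1 NKG) t"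
    and eq: "canonical_map G K ao am A = canonical_map G K ao am B"
  obtain a ms where ms: "(a, ms) \<in> simplices (nerve K) t" "A = orbit G nact (a, ms)"
      "length (filter (\<lambda>m. m \<notin> idents) ms) \<le> 1"
    by (rule skeleton_1_NKG[OF A])
  obtain b ns where ns: "(b, ns) \<in> simplices (nerve K) t" "B = orbit G nact (b, ns)"
    by (rule skeleton_1_NKG[OF B])
  have ab: "orbit G ao a = orbit G ao b" and cls: "map cls ms = map cls ns"
    using eq canonical_map_orbit[OF ms(1)] canonical_map_orbit[OF ns(1)] ms ns by auto
  have Mor: "set ms' \<subseteq> Mor K" if "chain K c ms'" for c ms'
    using that by (induction ms' arbitrary: c) auto
  have ch: "chain K a ms" "chain K b ns" using ms ns by (auto simp: nerve_def)
  have "list_all2 (\<lambda>u v. cls u = cls v) ms ns"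
    using cls map_eq_imp_length_eq[OF cls]
    by (auto simp: list_all2_conv_all_nth list_eq_iff_nth_eq)
  then have "list_all2 (\<lambda>u v. orbit G am u = orbit G am v) ms ns"
    using Mor[OF ch(1)] Mor[OF ch(2)] condition_R_cls[OF assms]
    by (elim list.rel_mono_strong) blast
  \<comment> \<open>The bound on non-identity factors turns the factorwise equalities into one
    element for the whole chain.\<close>
  then obtain g where "g \<in> carrier G" "nact g (a, ms) = (b, ns)"
    using act_chain_single_nonident[OF ch ab _ ms(3)] by (auto simp: nerve_act_def)
  then show "A = B" using orbit_nact[OF _ ms(1)] ms ns by metis
qed

text \<open>The generating simplex is \<open>x\<close> itself, pulled back along the identity
  map.\<close>

lemma mem_skeleton:
  assumes "x \<in> simplices (nerve K) n" "n \<le> d"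
  shows "orbit G nact x \<in> simplices (skeleton d NKG) n"
proof -
  interpret Q: simplicial_set NKG by (rule simplicial_set_quotient)
  let ?A = "orbit G nact x"
  have "(\<lambda>i \<in> {..n}. i) \<in> simplex_maps n n"
    by (auto simp: simplex_maps_def mono_on_def)
  moreover have A: "?A \<in> simplices NKG n" using assms simplices_NKG by blast
  moreover have "?A = smap NKG n n (\<lambda>i \<in> {..n}. i) ?A" using Q.smap_id[OF A] by (rule sym)
  ultimately show ?thesis
    using assms(2) unfolding simplices_skeleton by blast
qed

text \<open>Dimension 1 suffices: the two composites, viewed as edges, have the same image, and
  edges in one orbit have their morphisms in one orbit.\<close>

lemma inj_on_imp_condition_R:
  assumes "inj_on (canonical_map G K ao am) (simplices (skeleton 1 NKG) 1)"
  shows "condition_R G K am"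
  unfolding condition_R_def
proof (intro ballI impI)
  fix x ya yb
  assume x: "x \<in> Mor K" and y: "ya \<in> Mor K" "yb \<in> Mor K"
    and c: "Cod K x = Dom K ya" "Cod K x = Dom K yb" and o: "orbit G am ya = orbit G am yb"
  let ?z = "\<lambda>y. (Dom K x, [Comp K x y])"
  have z: "?z y \<in> simplices (nerve K) 1" if "y \<in> Mor K" "Cod K x = Dom K y" for y
    using x that by (simp add: nerve_def cat_simps)
  \<comment> \<open>This holds before (R) is known: both composites split as \<open>x\<close>
    followed by a factor from the same orbit.\<close>
  have "(Comp K x ya, Comp K x yb) \<in> rel"
    using rel_Comp[OF rel_orbit[OF x x refl] rel_orbit[OF y o] c] .
  then have "cls (Comp K x ya) = cls (Comp K x yb)"
    using cls_eq_iff x y c Comp_closed by blast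
  then have "canonical_map G K ao am (orbit G nact (?z ya))
      = canonical_map G K ao am (orbit G nact (?z yb))"
    using canonical_map_orbit[OF z] y c by simp
  then have "orbit G nact (?z ya) = orbit G nact (?z yb)"
    using inj_onD[OF assms] mem_skeleton[OF z] y c by simp
  then have "?z yb \<in> orbit G nact (?z ya)"
    using nact_orbit_refl[OF z[OF y(2) c(2)]] by simp
  then obtain g where "g \<in> carrier G" "Comp K x yb = am g (Comp K x ya)"
    by (auto simp: orbit_def nerve_act_def)
  then show "orbit G am (Comp K x ya) = orbit G am (Comp K x yb)"
    using mo.orbit_act Comp_closed x y c by simp
qed

end

theorem proposition5p3p3:
  fixes G :: "('g, 'b) monoid_scheme"
    and K :: "('o, 'm) cat"
    and ao :: "'g \<Rightarrow> 'o \<Rightarrow> 'o"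
    and am :: "'g \<Rightarrow> 'm \<Rightarrow> 'm"
  assumes "category_action G K ao am"
  shows "condition_R G K am \<longleftrightarrow>
    (\<forall>t. inj_on (canonical_map G K ao am)
       (simplices (skeleton 1 (quotient_sset G (nerve K) (nerve_act ao am))) t))"
proof -
  interpret category_action G K ao am by (rule assms)
  show ?thesis using condition_R_imp_inj_on inj_on_imp_condition_R by blast
qed

end
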